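(* Let $\lambda$ be the uniform law on $[0,1]$. Then $$\sup_{\nu\in\mathcal{P}([0,1]),\ \nu\ne\lambda}\frac{H(\nu|\lambda)}{\Sigma_\lambda(\nu)}=\infty,$$ that is, there is no finite constant $C$ such that $H(\nu|\lambda)\le C\,\Sigma_\lambda(\nu)$ for all probability measures $\nu$ on $[0,1]$.
   Context: $\mathcal{P}([0,1])$ is the set of Borel probability measures on $[0,1]$. $H(\nu|\lambda)=\int\ln\left(\frac{d\nu}{d\lambda}\right)d\nu$ if $\nu$ is absolutely continuous with respect to $\lambda$, and $+\infty$ otherwise (classical relative entropy). For $\nu\in\mathcal{P}([0,1])$, $$\Sigma_\lambda(\nu)=-\iint_{\mathbb{R}^2}\ln|x-y|\,d(\nu-\lambda)(x)\,d(\nu-\lambda)(y)\in[0,+\infty],$$ which is $+\infty$ when $\iint\ln|x-y|\,d\nu(x)\,d\nu(y)=-\infty$. *)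

theory Defs
  imports "HOL-Probability.Probability"
begin

(* Integral of an extended-real function as the difference of the integrals of its positive
   and negative parts, so that infinite values are kept (the Bochner integral would give 0).
   e2ennreal sends negative numbers to 0.  It is meaningful only if at least one of the two
   parts has a finite integral. *)
definition ext_integral :: "'a measure \<Rightarrow> ('a \<Rightarrow> ereal) \<Rightarrow> ereal" where
  "ext_integral M f =
     enn2ereal (\<integral>\<^sup>+ x. e2ennreal (f x) \<partial>M) - enn2ereal (\<integral>\<^sup>+ x. e2ennreal (- f x) \<partial>M)"

(* Borel probability measures on [0,1], represented as Borel measures on the real line that
   give full mass to [0,1]. *)
definition prob_unit :: "real measure set" where
  "prob_unit = {\<nu>. prob_space \<nu> \<and> sets \<nu> = sets borel \<and> emeasure \<nu> {0..1} = 1}"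

definition unif01 :: "real measure" where
  "unif01 = uniform_measure lborel {0..1}"

(* The library's KL_divergence is real-valued and gives 0 when the logarithm of the density is
   not integrable; here the value is extended-real and is \<infinity> in that case.  The points where
   the density is 0 or \<infinity> form a \<nu>-null set, so the values of ln and enn2real there do not
   matter.  If lam is finite,
   the negative part has a finite integral. *)
definition rel_entropy :: "'a measure \<Rightarrow> 'a measure \<Rightarrow> ereal" where
  "rel_entropy \<nu> lam =
     (if absolutely_continuous lam \<nu>
      then ext_integral \<nu> (\<lambda>x. ereal (ln (enn2real (RN_deriv lam \<nu> x))))
      else \<infinity>)"

(* In the library ln 0 = 0, so the value on the diagonal has to be set to -\<infinity> explicitly;
   otherwise atoms would not contribute. *)
definition log_kernel :: "real \<Rightarrow> real \<Rightarrow> ereal" where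
  "log_kernel x y = (if x = y then -\<infinity> else ereal (ln \<bar>x - y\<bar>))"

definition log_integral :: "real measure \<Rightarrow> real measure \<Rightarrow> ereal" where
  "log_integral \<mu> \<nu> = ext_integral (\<mu> \<Otimes>\<^sub>M \<nu>) (\<lambda>(x, y). log_kernel x y)"

(* The double integral against the signed measure (\<nu> - lam) \<otimes> (\<nu> - lam) is expanded
   bilinearly.  On measures carried by [0,1] the kernel is at most 0, and if lam is the uniform
   law the last three terms are finite, so no indeterminate form occurs. *)
definition Sigma_rel :: "real measure \<Rightarrow> real measure \<Rightarrow> ereal" where
  "Sigma_rel lam \<nu> =
     (if log_integral \<nu> \<nu> = -\<infinity> then \<infinity>
      else - (log_integral \<nu> \<nu> - log_integral \<nu> lam - log_integral lam \<nu> + log_integral lam lam))"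

end

theory Submission
  imports Defs
begin

text \<open>
  Take the densities 1 + cos (k x) / 2 on the unit interval, with k = 2 pi n and n large. Since
  x ln x is uniformly convex on bounded intervals, the relative entropy of these laws stays above a
  positive constant. For the energy, up to an additive constant (which cancels in the
  logarithmic energy of a difference of probability measures), - ln |x - y| is a mixture over
  t and z of the products 1[z - t \<le> x \<le> z] 1[z - t \<le> y \<le> z], with weight w(t). Hence
  the energy is the integral of w(t) (\<nu>[z - t, z] - \<lambda>[z - t, z])^2, which is nonnegative. The
  two laws differ by O(1/k) on every interval, and by O(t) on intervals of length t, so this
  integral tends to 0.
\<close>

section \<open>Extended-real integrals\<close>

lemma ext_integral_cong_AE:
  assumes "AE x in M. f x = g x"
  shows "ext_integral M f = ext_integral M g"
proof -
  have "(\<integral>\<^sup>+ x. e2ennreal (f x) \<partial>M) = (\<integral>\<^sup>+ x. e2ennreal (g x) \<partial>M)"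
    "(\<integral>\<^sup>+ x. e2ennreal (- f x) \<partial>M) = (\<integral>\<^sup>+ x. e2ennreal (- g x) \<partial>M)"
    using assms by (auto intro!: nn_integral_cong_AE)
  then show ?thesis by (simp add: ext_integral_def)
qed

lemma ext_integral_integrable:
  fixes f :: "'a \<Rightarrow> real"
  assumes "integrable M f"
  shows "ext_integral M (\<lambda>x. ereal (f x)) = ereal (integral\<^sup>L M f)"
proof -
  obtain a where a: "(\<integral>\<^sup>+ x. ennreal (f x) \<partial>M) = ennreal a" "0 \<le> a"
    using assms by (metis integrableD(2) ennreal_cases infinity_ennreal_def)
  obtain b where b: "(\<integral>\<^sup>+ x. ennreal (- f x) \<partial>M) = ennreal b" "0 \<le> b"
    using assms by (metis integrableD(3) ennreal_cases infinity_ennreal_def)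
  have "integral\<^sup>L M f = a - b"
    using real_lebesgue_integral_def[OF assms] a b by simp
  then show ?thesis
    using a b by (simp add: ext_integral_def e2ennreal_ereal enn2ereal_ennreal)
qed

section \<open>The logarithmic kernel as a mixture of interval indicators\<close>

text \<open>On (0, 1] the weight is the second derivative of - ln. The constant part on (1, 2] has
  total mass 1, which matches the slope - 1 of - ln at 1 and leaves only the additive constant 1/2.\<close>
definition scale_weight :: "real \<Rightarrow> real" where
  "scale_weight t = (if 0 < t \<and> t \<le> 2 then 1 / (min t 1)\<^sup>2 else 0)"

lemma scale_weight_nonneg [simp]: "0 \<le> scale_weight t"
  by (simp add: scale_weight_def)

lemma scale_weight_measurable [measurable]: "scale_weight \<in> borel_measurable borel"
  unfolding scale_weight_def by measurable

text \<open>The integrand vanishes for \<open>t < u\<close>, and the rest splits at 1. The primitive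
  \<open>ln t + u / t\<close> gives \<open>u - 1 - ln u\<close> on [u, 1], while [1, 2] gives
  \<open>3/2 - u\<close>, so the linear terms cancel.\<close>

lemma nn_integral_scale_weight:
  assumes "0 < u" "u \<le> 1"
  shows "(\<integral>\<^sup>+ t. ennreal (scale_weight t) * ennreal (t - u) \<partial>lborel) = ennreal (1/2 - ln u)"
proof -
  have "(\<integral>\<^sup>+ t. ennreal (scale_weight t) * ennreal (t - u) \<partial>lborel)
      = (\<integral>\<^sup>+ t. ennreal ((t - u) / t\<^sup>2) * indicator {u..1} t + ennreal (t - u) * indicator {1..2} t \<partial>lborel)"
  proof (rule nn_integral_cong_AE)
    show "AE t in lborel. ennreal (scale_weight t) * ennreal (t - u)
        = ennreal ((t - u) / t\<^sup>2) * indicator {u..1} t + ennreal (t - u) * indicator {1..2} t"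
      \<comment> \<open>Both indicators equal 1 at \<open>t = 1\<close>, so that point is discarded
        as a null set.\<close>
      using AE_lborel_singleton[of 1]
    proof eventually_elim
      fix t :: real assume "t \<noteq> 1"
      then show "ennreal (scale_weight t) * ennreal (t - u)
        = ennreal ((t - u) / t\<^sup>2) * indicator {u..1} t + ennreal (t - u) * indicator {1..2} t"
        using assms
        by (auto simp: scale_weight_def indicator_def min_def ennreal_mult'[symmetric]
            intro!: ennreal_neg divide_nonpos_nonneg)
    qed
  qed
  also have "\<dots> = (\<integral>\<^sup>+ t. ennreal ((t - u) / t\<^sup>2) * indicator {u..1} t \<partial>lborel)
      + (\<integral>\<^sup>+ t. ennreal (t - u) * indicator {1..2} t \<partial>lborel)"
    by (rule nn_integral_add) auto
  also have "(\<integral>\<^sup>+ t. ennreal ((t - u) / t\<^sup>2) * indicator {u..1} t \<partial>lborel)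
      = ennreal ((ln 1 + u / 1) - (ln u + u / u))"
    using assms
    by (intro nn_integral_FTC_Icc[where F = "\<lambda>t. ln t + u / t"])
      (auto intro!: derivative_eq_intros simp: field_simps power2_eq_square)
  also have "(\<integral>\<^sup>+ t. ennreal (t - u) * indicator {1..2} t \<partial>lborel)
      = ennreal ((2 - u)\<^sup>2 / 2 - (1 - u)\<^sup>2 / 2)"
    using assms
    by (intro nn_integral_FTC_Icc[where F = "\<lambda>t. (t - u)\<^sup>2 / 2"])
      (auto intro!: derivative_eq_intros)
  also have "ennreal ((ln 1 + u / 1) - (ln u + u / u)) + ennreal ((2 - u)\<^sup>2 / 2 - (1 - u)\<^sup>2 / 2)
      = ennreal (1/2 - ln u)"
  proof -
    \<comment> \<open>This makes the first summand nonnegative, so that \<open>ennreal\<close> is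
      additive here.\<close>
    have "ln u \<le> u - 1" using assms ln_le_minus_one by blast
    moreover have "(2 - u)\<^sup>2 / 2 - (1 - u)\<^sup>2 / 2 = 3/2 - u" by (simp add: power2_eq_square field_simps)
    ultimately show ?thesis using assms by (subst ennreal_plus[symmetric]) auto
  qed
  finally show ?thesis .
qed

text \<open>A window [z - t, z] contains both points exactly when z lies in [max x y, min x y + t],
  an interval of length t - |x - y|, empty if this is negative. Integrating out z leaves the
  one-dimensional integral above with u = |x - y|.\<close>

lemma log_kernel_decomposition:
  assumes "x \<in> {0..1}" "y \<in> {0..1}" "x \<noteq> y"
  shows "(\<integral>\<^sup>+ t. \<integral>\<^sup>+ z. ennreal (scale_weight t) * (indicator {z - t..z} x * indicator {z - t..z} y) \<partial>lborel \<partial>lborel)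
     = ennreal (1/2 - ln \<bar>x - y\<bar>)"
proof -
  have "(\<integral>\<^sup>+ z. ennreal (scale_weight t) * (indicator {z - t..z} x * indicator {z - t..z} y) \<partial>lborel)
     = ennreal (scale_weight t) * ennreal (t - \<bar>x - y\<bar>)" for t
  proof -
    have "(\<integral>\<^sup>+ z. ennreal (scale_weight t) * (indicator {z - t..z} x * indicator {z - t..z} y) \<partial>lborel)
        = (\<integral>\<^sup>+ z. ennreal (scale_weight t) * indicator {max x y..min x y + t} z \<partial>lborel)"
      by (intro nn_integral_cong) (auto simp: indicator_def)
    also have "\<dots> = ennreal (scale_weight t) * emeasure lborel {max x y..min x y + t}"
      by (rule nn_integral_cmult_indicator) simp
    also have "emeasure lborel {max x y..min x y + t} = ennreal (t - \<bar>x - y\<bar>)"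
      by (auto simp: emeasure_lborel_Icc_eq ennreal_neg intro!: arg_cong[where f = ennreal])
    finally show ?thesis .
  qed
  then show ?thesis
    using nn_integral_scale_weight[of "\<bar>x - y\<bar>"] assms by auto
qed

section \<open>Logarithmic energy as an integral over windows\<close>

text \<open>The window mass is the integral over x of the indicator of a closed set in (t, z, x),
  hence jointly measurable in t and z.\<close>

lemma measure_sliding_window_measurable:
  fixes \<mu> :: "real measure"
  assumes "prob_space \<mu>" and [measurable_cong]: "sets \<mu> = sets borel"
  shows "(\<lambda>(t, z). measure \<mu> {z - t..z}) \<in> borel_measurable (lborel \<Otimes>\<^sub>M lborel)"
proof -
  interpret prob_space \<mu> by fact
  have "(\<lambda>q. \<integral>\<^sup>+ x. indicator {p. snd (fst p) - fst (fst p) \<le> snd p \<and> snd p \<le> snd (fst p)} (q, x) \<partial>\<mu>)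
      \<in> borel_measurable (lborel \<Otimes>\<^sub>M lborel)"
    by measurable
  moreover have "(\<lambda>q. \<integral>\<^sup>+ x. indicator {p. snd (fst p) - fst (fst p) \<le> snd p \<and> snd p \<le> snd (fst p)} (q, x) \<partial>\<mu>)
     = (\<lambda>(t, z). emeasure \<mu> {z - t..z})"
  proof (intro ext, clarify)
    fix t z :: real
    have "(\<integral>\<^sup>+ x. indicator {p. snd (fst p) - fst (fst p) \<le> snd p \<and> snd p \<le> snd (fst p)} ((t, z), x) \<partial>\<mu>)
       = (\<integral>\<^sup>+ x. indicator {z - t..z} x \<partial>\<mu>)"
      by (intro nn_integral_cong) (auto simp: indicator_def)
    then show "(\<integral>\<^sup>+ x. indicator {p. snd (fst p) - fst (fst p) \<le> snd p \<and> snd p \<le> snd (fst p)} ((t, z), x) \<partial>\<mu>)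
       = emeasure \<mu> {z - t..z}"
      by (simp add: assms)
  qed
  ultimately show ?thesis
    unfolding measure_def case_prod_beta by (intro borel_measurable_enn2real) simp
qed

text \<open>Arbitrary measurable coordinate functions are allowed so that one fact serves every
  order of integration in the Tonelli argument below.\<close>

lemma window_pair_measurable:
  assumes [measurable]: "t \<in> borel_measurable L" "z \<in> borel_measurable L"
      "x \<in> borel_measurable L" "y \<in> borel_measurable L"
  shows "(\<lambda>p. ennreal (scale_weight (t p)) *
    (indicator {z p - t p..z p} (x p) * indicator {z p - t p..z p} (y p))) \<in> borel_measurable L"
  unfolding indicator_def atLeastAtMost_iff by measurable

lemma nn_integral_log_energy:
  fixes \<mu> \<nu> :: "real measure"
  assumes \<mu>: "prob_space \<mu>" and s\<mu>[measurable_cong]: "sets \<mu> = sets borel"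
    and \<nu>: "prob_space \<nu>" and s\<nu>[measurable_cong]: "sets \<nu> = sets borel"
    and AE\<mu>: "AE x in \<mu>. x \<in> {0..1}" and AE\<nu>: "AE x in \<nu>. x \<in> {0..1}"
    and nonatomic: "\<And>x. AE y in \<nu>. x \<noteq> y"
  shows "(\<integral>\<^sup>+ x. \<integral>\<^sup>+ y. ennreal (1/2 - ln \<bar>x - y\<bar>) \<partial>\<nu> \<partial>\<mu>)
     = (\<integral>\<^sup>+ t. \<integral>\<^sup>+ z. ennreal (scale_weight t * (measure \<mu> {z - t..z} * measure \<nu> {z - t..z})) \<partial>lborel \<partial>lborel)"
proof -
  interpret M: prob_space \<mu> by fact
  interpret N: prob_space \<nu> by fact
  interpret MB: pair_sigma_finite \<mu> lborel ..
  interpret NB: pair_sigma_finite \<nu> lborel ..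
  define f :: "real \<Rightarrow> real \<Rightarrow> real \<Rightarrow> real \<Rightarrow> ennreal" where
    "f t z x y = ennreal (scale_weight t) * (indicator {z - t..z} x * indicator {z - t..z} y)" for t z x y
  note [measurable] = window_pair_measurable[folded f_def]
  \<comment> \<open>For a fixed window the integrand is a product of a function of x and a function
    of y, so the double integral factorises.\<close>
  have inner: "(\<integral>\<^sup>+ x. \<integral>\<^sup>+ y. f t z x y \<partial>\<nu> \<partial>\<mu>)
      = ennreal (scale_weight t * (measure \<mu> {z - t..z} * measure \<nu> {z - t..z}))" for t z
    by (simp add: f_def nn_integral_cmult nn_integral_multc s\<mu> s\<nu> M.emeasure_eq_measure
        N.emeasure_eq_measure ennreal_mult)
  have "(\<integral>\<^sup>+ x. \<integral>\<^sup>+ y. ennreal (1/2 - ln \<bar>x - y\<bar>) \<partial>\<nu> \<partial>\<mu>)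
      = (\<integral>\<^sup>+ x. \<integral>\<^sup>+ y. \<integral>\<^sup>+ t. \<integral>\<^sup>+ z. f t z x y \<partial>lborel \<partial>lborel \<partial>\<nu> \<partial>\<mu>)"
    using AE\<mu>
  proof (intro nn_integral_cong_AE, eventually_elim)
    fix x :: real assume x: "x \<in> {0..1}"
    show "(\<integral>\<^sup>+ y. ennreal (1/2 - ln \<bar>x - y\<bar>) \<partial>\<nu>)
        = (\<integral>\<^sup>+ y. \<integral>\<^sup>+ t. \<integral>\<^sup>+ z. f t z x y \<partial>lborel \<partial>lborel \<partial>\<nu>)"
      using AE\<nu> nonatomic[of x]
      by (intro nn_integral_cong_AE, eventually_elim)
        (unfold f_def, rule log_kernel_decomposition[OF x, symmetric], auto)
  qed
  \<comment> \<open>Four interchanges follow: t and then z pass the integral over \<nu>, after that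
    t and then z pass the integral over \<mu>.\<close>
  also have "\<dots> = (\<integral>\<^sup>+ x. \<integral>\<^sup>+ t. \<integral>\<^sup>+ y. \<integral>\<^sup>+ z. f t z x y \<partial>lborel \<partial>\<nu> \<partial>lborel \<partial>\<mu>)"
    by (intro nn_integral_cong NB.Fubini'[symmetric]) measurable
  also have "\<dots> = (\<integral>\<^sup>+ x. \<integral>\<^sup>+ t. \<integral>\<^sup>+ z. \<integral>\<^sup>+ y. f t z x y \<partial>\<nu> \<partial>lborel \<partial>lborel \<partial>\<mu>)"
    by (intro nn_integral_cong NB.Fubini'[symmetric]) measurable
  also have "\<dots> = (\<integral>\<^sup>+ t. \<integral>\<^sup>+ x. \<integral>\<^sup>+ z. \<integral>\<^sup>+ y. f t z x y \<partial>\<nu> \<partial>lborel \<partial>\<mu> \<partial>lborel)"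
    by (intro MB.Fubini'[symmetric]) measurable
  also have "\<dots> = (\<integral>\<^sup>+ t. \<integral>\<^sup>+ z. \<integral>\<^sup>+ x. \<integral>\<^sup>+ y. f t z x y \<partial>\<nu> \<partial>\<mu> \<partial>lborel \<partial>lborel)"
    by (intro nn_integral_cong MB.Fubini'[symmetric]) measurable
  also have "\<dots> = (\<integral>\<^sup>+ t. \<integral>\<^sup>+ z. ennreal (scale_weight t * (measure \<mu> {z - t..z} * measure \<nu> {z - t..z})) \<partial>lborel \<partial>lborel)"
    by (simp only: inner)
  finally show ?thesis .
qed


text \<open>As a function on the (t, z) plane it turns each energy into a single integral. It is
  bilinear in the two window masses, which later lets four energies combine into a square.\<close>

definition window_product :: "real measure \<Rightarrow> real measure \<Rightarrow> real \<times> real \<Rightarrow> real" where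
  "window_product \<mu> \<nu> = (\<lambda>(t, z). scale_weight t * (measure \<mu> {z - t..z} * measure \<nu> {z - t..z}))"

text \<open>The shifted kernel \<open>h\<close> = 1/2 - ln |x - y| is nonnegative almost everywhere,
  so its integral follows from the Tonelli identity. Finiteness of that integral makes
  \<open>h\<close> integrable, and subtracting it from 1/2 is then legitimate.\<close>

lemma log_integral_eq:
  fixes \<mu> \<nu> :: "real measure"
  assumes \<mu>: "prob_space \<mu>" and s\<mu>[measurable_cong]: "sets \<mu> = sets borel"
    and \<nu>: "prob_space \<nu>" and s\<nu>[measurable_cong]: "sets \<nu> = sets borel"
    and AE\<mu>: "AE x in \<mu>. x \<in> {0..1}" and AE\<nu>: "AE x in \<nu>. x \<in> {0..1}"
    and nonatomic: "\<And>x. AE y in \<nu>. x \<noteq> y"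
    and int: "integrable (lborel \<Otimes>\<^sub>M lborel) (window_product \<mu> \<nu>)" (is "integrable _ ?W")
  shows "log_integral \<mu> \<nu> = ereal (1/2 - integral\<^sup>L (lborel \<Otimes>\<^sub>M lborel) (window_product \<mu> \<nu>))"
proof -
  interpret M: prob_space \<mu> by fact
  interpret N: prob_space \<nu> by fact
  interpret MN: pair_prob_space \<mu> \<nu> ..
  define h where "h p = 1/2 - ln \<bar>fst p - snd p\<bar>" for p :: "real \<times> real"
  have [measurable]: "h \<in> borel_measurable (\<mu> \<Otimes>\<^sub>M \<nu>)"
    unfolding h_def by measurable
  have AE: "AE p in \<mu> \<Otimes>\<^sub>M \<nu>. fst p \<in> {0..1} \<and> snd p \<in> {0..1} \<and> fst p \<noteq> snd p"
  proof (rule MN.AE_pair_measure)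
    show "AE x in \<mu>. AE y in \<nu>. fst (x, y) \<in> {0..1} \<and> snd (x, y) \<in> {0..1} \<and> fst (x, y) \<noteq> snd (x, y)"
      using AE\<mu>
    proof eventually_elim
      fix x :: real assume x: "x \<in> {0..1}"
      show "AE y in \<nu>. fst (x, y) \<in> {0..1} \<and> snd (x, y) \<in> {0..1} \<and> fst (x, y) \<noteq> snd (x, y)"
        using AE\<nu> nonatomic[of x] by eventually_elim (use x in auto)
    qed
  qed (unfold atLeastAtMost_iff, measurable)
  have h_nonneg: "AE p in \<mu> \<Otimes>\<^sub>M \<nu>. 0 \<le> h p"
    using AE
  proof eventually_elim
    case (elim p)
    then have "\<bar>fst p - snd p\<bar> \<le> 1" "0 < \<bar>fst p - snd p\<bar>" by auto
    then have "ln \<bar>fst p - snd p\<bar> \<le> 0" by simp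
    then show ?case by (simp add: h_def)
  qed
  have W_nonneg: "0 \<le> ?W q" for q
    by (simp add: window_product_def case_prod_beta)
  have "(\<integral>\<^sup>+ p. ennreal (h p) \<partial>(\<mu> \<Otimes>\<^sub>M \<nu>)) = (\<integral>\<^sup>+ x. \<integral>\<^sup>+ y. ennreal (1/2 - ln \<bar>x - y\<bar>) \<partial>\<nu> \<partial>\<mu>)"
    by (subst N.nn_integral_fst[symmetric]) (simp_all add: h_def)
  also have "\<dots> = (\<integral>\<^sup>+ t. \<integral>\<^sup>+ z. ennreal (?W (t, z)) \<partial>lborel \<partial>lborel)"
    using nn_integral_log_energy[OF \<mu> s\<mu> \<nu> s\<nu> AE\<mu> AE\<nu> nonatomic] by (simp add: window_product_def)
  also have "\<dots> = (\<integral>\<^sup>+ q. ennreal (?W q) \<partial>(lborel \<Otimes>\<^sub>M lborel))"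
    using int by (intro lborel.nn_integral_fst) (auto dest: borel_measurable_integrable)
  also have "\<dots> = ennreal (integral\<^sup>L (lborel \<Otimes>\<^sub>M lborel) ?W)"
    using int W_nonneg by (intro nn_integral_eq_integral) auto
  finally have nn: "(\<integral>\<^sup>+ p. ennreal (h p) \<partial>(\<mu> \<Otimes>\<^sub>M \<nu>)) = ennreal (integral\<^sup>L (lborel \<Otimes>\<^sub>M lborel) ?W)" .
  then have int_h: "integrable (\<mu> \<Otimes>\<^sub>M \<nu>) h"
    using h_nonneg by (intro integrableI_nonneg) auto
  have integral_h: "integral\<^sup>L (\<mu> \<Otimes>\<^sub>M \<nu>) h = integral\<^sup>L (lborel \<Otimes>\<^sub>M lborel) ?W"
    using integral_eq_nn_integral[OF _ h_nonneg] nn W_nonneg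
    by (simp add: enn2real_ennreal integral_nonneg)
  \<comment> \<open>The value -\<infinity> of the kernel occurs only on the diagonal, a null set
    here.\<close>
  have "log_integral \<mu> \<nu> = ext_integral (\<mu> \<Otimes>\<^sub>M \<nu>) (\<lambda>p. ereal (1/2 - h p))"
    unfolding log_integral_def using AE
    by (intro ext_integral_cong_AE, eventually_elim) (auto simp: log_kernel_def h_def case_prod_beta)
  also have "\<dots> = ereal (integral\<^sup>L (\<mu> \<Otimes>\<^sub>M \<nu>) (\<lambda>p. 1/2 - h p))"
    using int_h by (intro ext_integral_integrable) simp
  also have "integral\<^sup>L (\<mu> \<Otimes>\<^sub>M \<nu>) (\<lambda>p. 1/2 - h p) = 1/2 - integral\<^sup>L (lborel \<Otimes>\<^sub>M lborel) ?W"
    using int_h integral_h by (simp add: MN.prob_space)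
  finally show ?thesis .
qed

section \<open>The oscillating laws and their window masses\<close>

text \<open>The amplitude \<open>c\<close> is a parameter so that \<open>c = 0\<close>, the uniform
  law, belongs to the same family and every energy needed is between two members of it.\<close>

definition cos_law :: "real \<Rightarrow> real \<Rightarrow> real measure" where
  "cos_law c k = density lborel (\<lambda>x. ennreal (1 + c * cos (k * x)) * indicator {0..1} x)"

lemma sets_cos_law [simp, measurable_cong]: "sets (cos_law c k) = sets borel"
  by (simp add: cos_law_def)

lemma space_cos_law [simp]: "space (cos_law c k) = UNIV"
  by (simp add: cos_law_def)

text \<open>Leaving \<open>k\<close> free lets the uniform law be written with the frequency of the
  law it is compared with.\<close>

lemma unif01_eq_cos_law: "unif01 = cos_law 0 k"
  by (auto simp: unif01_def uniform_measure_def cos_law_def divide_ennreal_def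
      intro!: arg_cong[where f = "density lborel"])

lemma cos_law_density_nonneg:
  fixes x :: real
  assumes "0 \<le> c" "c \<le> 1"
  shows "0 \<le> 1 + c * cos x"
proof -
  have "\<bar>c * cos x\<bar> \<le> 1" using assms by (simp add: abs_mult mult_le_one)
  then show ?thesis by linarith
qed

lemma emeasure_cos_law_Icc:
  assumes c: "0 \<le> c" "c \<le> 1" and "k \<noteq> 0" and ab: "0 \<le> a" "a \<le> b" "b \<le> 1"
  shows "emeasure (cos_law c k) {a..b} = ennreal (b - a + c * (sin (k * b) - sin (k * a)) / k)"
proof -
  have "emeasure (cos_law c k) {a..b}
      = (\<integral>\<^sup>+ x. ennreal (1 + c * cos (k * x)) * indicator {a..b} x \<partial>lborel)"
    unfolding cos_law_def using ab
    by (subst emeasure_density) (auto simp: indicator_def intro!: nn_integral_cong)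
  also have "\<dots> = ennreal ((b + c * sin (k * b) / k) - (a + c * sin (k * a) / k))"
    using assms
    by (intro nn_integral_FTC_Icc[where F = "\<lambda>x. x + c * sin (k * x) / k"])
      (auto intro!: derivative_eq_intros cos_law_density_nonneg)
  finally show ?thesis by (simp add: algebra_simps diff_divide_distrib)
qed

lemma abs_sin_diff_le: "\<bar>sin x - sin y\<bar> \<le> \<bar>x - y\<bar>" for x y :: real
proof -
  have "\<bar>sin x - sin y\<bar> = 2 * \<bar>sin ((x - y) / 2)\<bar> * \<bar>cos ((x + y) / 2)\<bar>"
    by (simp add: sin_diff_sin abs_mult)
  also have "\<dots> \<le> 2 * \<bar>(x - y) / 2\<bar> * 1"
    by (intro mult_mono mult_left_mono abs_sin_x_le_abs_x) auto
  finally show ?thesis by simp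
qed

text \<open>The Lipschitz bound on sine gives the first estimate, useful on short intervals.
  Boundedness of sine gives the second, which is small for high frequency whatever the
  length.\<close>

lemma abs_cos_law_correction_le:
  fixes a b :: real
  assumes c: "0 \<le> c" "c \<le> 1" and k: "k > 0" and ab: "a \<le> b"
  shows "\<bar>c * (sin (k * b) - sin (k * a)) / k\<bar> \<le> b - a"
    and "\<bar>c * (sin (k * b) - sin (k * a)) / k\<bar> \<le> 2 * c / k"
proof -
  have "\<bar>sin (k * b) - sin (k * a)\<bar> \<le> k * (b - a)"
    using abs_sin_diff_le[of "k * b" "k * a"] k ab by (simp add: abs_mult right_diff_distrib[symmetric])
  then have "c * \<bar>sin (k * b) - sin (k * a)\<bar> \<le> 1 * (k * (b - a))"
    using c by (intro mult_mono) auto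
  then show "\<bar>c * (sin (k * b) - sin (k * a)) / k\<bar> \<le> b - a"
    using c k by (simp add: abs_mult divide_le_eq mult.commute)
  have "\<bar>sin (k * b) - sin (k * a)\<bar> \<le> 2"
    using abs_sin_le_one[of "k * b"] abs_sin_le_one[of "k * a"] by linarith
  then have "c * \<bar>sin (k * b) - sin (k * a)\<bar> \<le> c * 2"
    using c by (intro mult_left_mono)
  then show "\<bar>c * (sin (k * b) - sin (k * a)) / k\<bar> \<le> 2 * c / k"
    using c k by (simp add: abs_mult divide_right_mono mult.commute)
qed

text \<open>Only the part [a, b] of the window inside [0, 1] carries mass, and a > b means that this
  part is empty.\<close>

lemma measure_cos_law_window:
  assumes c: "0 \<le> c" "c \<le> 1" and k: "k > 0"
  shows "measure (cos_law c k) {z - t..z} =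
    (let a = max 0 (z - t); b = min 1 z in
      if a \<le> b then b - a + c * (sin (k * b) - sin (k * a)) / k else 0)"
proof -
  define a b where "a = max 0 (z - t)" and "b = min 1 z"
  have "emeasure (cos_law c k) {z - t..z} = emeasure (cos_law c k) {a..b}"
    unfolding cos_law_def a_def b_def
    by (subst (1 2) emeasure_density) (auto simp: indicator_def intro!: nn_integral_cong)
  then have eq: "measure (cos_law c k) {z - t..z} = measure (cos_law c k) {a..b}"
    by (simp add: measure_def)
  show ?thesis
  proof (cases "a \<le> b")
    case True
    \<comment> \<open>The value is nonnegative, so converting it from \<open>ennreal\<close> back to
      a real does not truncate it.\<close>
    have "0 \<le> b - a + c * (sin (k * b) - sin (k * a)) / k"
      using abs_cos_law_correction_le(1)[OF c k True] by linarith
    then show ?thesis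
      using True emeasure_cos_law_Icc[OF c, of k a b] k eq
      unfolding a_def[symmetric] b_def[symmetric] Let_def
      by (simp add: measure_def a_def b_def)
  next
    case False
    then show ?thesis using eq unfolding a_def[symmetric] b_def[symmetric] Let_def by simp
  qed
qed


text \<open>The first two bounds come from a density of at most 2, and together they compensate the
  singular weight. The third confines z to a bounded range, since a window of length at most 2 that
  meets [0, 1] ends in [0, 3]. The fourth supplies the decay in \<open>k\<close>.\<close>

lemma cos_law_window_bounds:
  assumes c: "0 \<le> c" "c \<le> 1" and k: "k > 0" and t: "0 \<le> t" "t \<le> 2"
  shows "measure (cos_law c k) {z - t..z} \<le> 2 * t"
    and "measure (cos_law c k) {z - t..z} \<le> 2"
    and "z \<notin> {0..3} \<Longrightarrow> measure (cos_law c k) {z - t..z} = 0"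
    and "\<bar>measure (cos_law c k) {z - t..z} - measure (cos_law 0 k) {z - t..z}\<bar> \<le> 2 * c / k"
proof -
  define a b where "a = max 0 (z - t)" and "b = min 1 z"
  have eq: "measure (cos_law d k) {z - t..z} =
      (if a \<le> b then b - a + d * (sin (k * b) - sin (k * a)) / k else 0)" if "0 \<le> d" "d \<le> 1" for d
    using measure_cos_law_window[OF that k] by (simp add: a_def b_def Let_def)
  have le: "measure (cos_law c k) {z - t..z} \<le> 2 * max 0 (b - a)"
    using eq[OF c] abs_le_D1[OF abs_cos_law_correction_le(1)[OF c k, of a b]] by auto
  have "max 0 (b - a) \<le> t" "max 0 (b - a) \<le> 1"
    using t unfolding a_def b_def by linarith+
  from order_trans[OF le mult_left_mono[OF this(1)]] order_trans[OF le mult_left_mono[OF this(2)]]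
  show "measure (cos_law c k) {z - t..z} \<le> 2 * t" "measure (cos_law c k) {z - t..z} \<le> 2"
    by simp_all
  show "measure (cos_law c k) {z - t..z} = 0" if "z \<notin> {0..3}"
    using eq[OF c] that t by (auto simp: a_def b_def)
  show "\<bar>measure (cos_law c k) {z - t..z} - measure (cos_law 0 k) {z - t..z}\<bar> \<le> 2 * c / k"
    using eq[OF c] eq[of 0] abs_cos_law_correction_le(2)[OF c k, of a b] c k by auto
qed

text \<open>With \<open>k\<close> a multiple of 2 pi the sine vanishes at both ends of [0, 1], so
  the oscillation adds no total mass. Having a density, the law has no atoms.\<close>

lemma cos_law_basic:
  assumes c: "0 \<le> c" "c \<le> 1" and n: "n > 0"
  defines "k \<equiv> 2 * pi * real n"
  shows "prob_space (cos_law c k)" "AE x in cos_law c k. x \<in> {0..1}" "AE y in cos_law c k. x \<noteq> y"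
    and "cos_law c k \<in> prob_unit"
proof -
  have "k \<noteq> 0" using n by (simp add: k_def)
  have "sin k = 0" using sin_npi2 n unfolding k_def by (metis mult.assoc mult.commute sin_2npi)
  then have one: "emeasure (cos_law c k) {0..1} = 1"
    using emeasure_cos_law_Icc[OF c \<open>k \<noteq> 0\<close>, of 0 1] by simp
  have "emeasure (cos_law c k) UNIV = emeasure (cos_law c k) {0..1}"
    unfolding cos_law_def by (subst (1 2) emeasure_density) (auto simp: indicator_def intro!: nn_integral_cong)
  then show p: "prob_space (cos_law c k)"
    using one by (intro prob_spaceI) simp
  show "cos_law c k \<in> prob_unit" using p one by (simp add: prob_unit_def)
  show "AE x in cos_law c k. x \<in> {0..1}"
    unfolding cos_law_def by (subst AE_density) (auto simp: indicator_def)
  show "AE y in cos_law c k. x \<noteq> y"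
    unfolding cos_law_def using AE_lborel_singleton[of x]
    by (subst AE_density) (auto elim: eventually_mono)
qed

section \<open>Integrability in the window parameters\<close>

lemma emeasure_lborel_rectangle:
  fixes a b c d :: real
  assumes "a \<le> b" "c \<le> d"
  shows "emeasure (lborel \<Otimes>\<^sub>M lborel) ({a..b} \<times> {c..d}) = ennreal ((b - a) * (d - c))"
  using assms by (simp add: lborel.emeasure_pair_measure_Times ennreal_mult)

lemma integrable_rectangle:
  "integrable (lborel \<Otimes>\<^sub>M lborel) (indicator ({a..b} \<times> {c..d}) :: _ \<Rightarrow> real)" for a b c d :: real
  by (intro integrable_real_indicator)
    (auto simp: lborel.emeasure_pair_measure_Times emeasure_lborel_Icc_eq ennreal_mult_less_top)

lemma integral_rectangle:
  fixes a b c d :: real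
  assumes "a \<le> b" "c \<le> d"
  shows "(\<integral>q. indicator ({a..b} \<times> {c..d}) q \<partial>(lborel \<Otimes>\<^sub>M lborel)) = (b - a) * (d - c)"
  using emeasure_lborel_rectangle[OF assms] assms
  by (simp add: measure_def space_pair_measure)

lemma window_product_measurable:
  assumes "prob_space \<mu>" "sets \<mu> = sets borel" "prob_space \<nu>" "sets \<nu> = sets borel"
  shows "window_product \<mu> \<nu> \<in> borel_measurable (lborel \<Otimes>\<^sub>M lborel)"
proof -
  note [measurable] = measure_sliding_window_measurable[OF assms(1,2), unfolded case_prod_beta]
    measure_sliding_window_measurable[OF assms(3,4), unfolded case_prod_beta]
  show ?thesis unfolding window_product_def case_prod_beta by measurable
qed

text \<open>Each window mass is at most 2 min(t, 1), so the product of two cancels the weight 1 /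
  min(t, 1)^2. Hence 4 times the indicator of [0, 2] x [0, 3] dominates.\<close>

lemma integrable_window_product_cos_law:
  assumes "0 \<le> c" "c \<le> 1" "0 \<le> d" "d \<le> 1" "n > 0"
  defines "k \<equiv> 2 * pi * real n"
  shows "integrable (lborel \<Otimes>\<^sub>M lborel) (window_product (cos_law c k) (cos_law d k))"
proof (rule Bochner_Integration.integrable_bound)
  show "integrable (lborel \<Otimes>\<^sub>M lborel) (\<lambda>q. 4 * indicator ({0..2::real} \<times> {0..3::real}) q :: real)"
    by (intro integrable_mult_right integrable_rectangle)
  show "window_product (cos_law c k) (cos_law d k) \<in> borel_measurable (lborel \<Otimes>\<^sub>M lborel)"
    using cos_law_basic(1) assms by (intro window_product_measurable) auto
  show "AE q in lborel \<Otimes>\<^sub>M lborel. norm (window_product (cos_law c k) (cos_law d k) q)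
      \<le> norm (4 * indicator ({0..2} \<times> {0..3}) q :: real)"
  proof (rule AE_I2, clarify)
    fix t z :: real
    let ?p = "measure (cos_law c k) {z - t..z}" and ?q = "measure (cos_law d k) {z - t..z}"
    have k: "k > 0" using assms by simp
    show "norm (window_product (cos_law c k) (cos_law d k) (t, z))
      \<le> norm (4 * indicator ({0..2} \<times> {0..3}) (t, z) :: real)"
    proof (cases "0 < t \<and> t \<le> 2")
      case True
      note p = cos_law_window_bounds[of c k t z] and q = cos_law_window_bounds[of d k t z]
      show ?thesis
      proof (cases "z \<in> {0..3}")
        case z: True
        have "?p * ?q \<le> (2 * min t 1) * (2 * min t 1)"
          using p(1,2) q(1,2) assms k True by (intro mult_mono) (auto simp: min_def)
        then have "scale_weight t * (?p * ?q) \<le> 4"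
          using True by (simp add: scale_weight_def divide_le_eq power2_eq_square)
        then show ?thesis
          using True z by (simp add: window_product_def)
      next
        case False
        then show ?thesis using p(3) assms k True by (simp add: window_product_def)
      qed
    next
      case False
      then show ?thesis by (auto simp: window_product_def scale_weight_def)
    qed
  qed
qed

section \<open>Energy of the oscillating laws relative to the uniform law\<close>

text \<open>All four logarithmic integrals are finite. Their constants 1/2 cancel because the signs
  sum to zero, and the four window products combine into the square of a difference.\<close>

lemma Sigma_rel_cos_law:
  assumes c: "0 \<le> c" "c \<le> 1" and n: "n > 0"
  defines "k \<equiv> 2 * pi * real n"
  shows "Sigma_rel unif01 (cos_law c k) = ereal (\<integral>q. scale_weight (fst q) *
     (measure (cos_law c k) {snd q - fst q..snd q} - measure (cos_law 0 k) {snd q - fst q..snd q})\<^sup>2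
     \<partial>(lborel \<Otimes>\<^sub>M lborel))"
proof -
  let ?I = "\<lambda>d e. \<integral>q. window_product (cos_law d k) (cos_law e k) q \<partial>(lborel \<Otimes>\<^sub>M lborel)"
  have L: "log_integral (cos_law d k) (cos_law e k) = ereal (1/2 - ?I d e)"
    if "0 \<le> d" "d \<le> 1" "0 \<le> e" "e \<le> 1" for d e
    using that n unfolding k_def
    by (intro log_integral_eq cos_law_basic sets_cos_law integrable_window_product_cos_law)
  note int = integrable_window_product_cos_law[OF _ _ _ _ n, folded k_def]
  have "Sigma_rel unif01 (cos_law c k) = ereal (?I c c - ?I c 0 - ?I 0 c + ?I 0 0)"
    unfolding Sigma_rel_def unif01_eq_cos_law[of k] using c by (simp add: L)
  also have "?I c c - ?I c 0 - ?I 0 c + ?I 0 0 = (\<integral>q. window_product (cos_law c k) (cos_law c k) q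
      - window_product (cos_law c k) (cos_law 0 k) q - window_product (cos_law 0 k) (cos_law c k) q
      + window_product (cos_law 0 k) (cos_law 0 k) q \<partial>(lborel \<Otimes>\<^sub>M lborel))"
    using c by (simp add: int)
  also have "\<dots> = (\<integral>q. scale_weight (fst q) *
     (measure (cos_law c k) {snd q - fst q..snd q} - measure (cos_law 0 k) {snd q - fst q..snd q})\<^sup>2
     \<partial>(lborel \<Otimes>\<^sub>M lborel))"
    by (intro Bochner_Integration.integral_cong refl)
      (simp add: window_product_def case_prod_beta power2_eq_square algebra_simps)
  finally show ?thesis .
qed


text \<open>The integral is split at t = \<epsilon>. For short windows the difference is at most 2t,
  so the integrand is at most 4 on an area of 3\<epsilon>. For longer ones the weight is at most
  1/\<epsilon>^2 and the difference at most \<epsilon>^2, so the integrand is at most \<epsilon>^2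
  on an area of at most 6. The total is at most 12\<epsilon> + 6\<epsilon>^2.\<close>

lemma Sigma_rel_cos_law_bounds:
  assumes c: "0 \<le> c" "c \<le> 1" and n: "n > 0" and \<epsilon>: "0 < \<epsilon>" "\<epsilon> \<le> 1"
  defines "k \<equiv> 2 * pi * real n"
  assumes small: "2 * c / k \<le> \<epsilon>\<^sup>2"
  obtains s where "Sigma_rel unif01 (cos_law c k) = ereal s" "0 \<le> s" "s \<le> 18 * \<epsilon>"
proof
  let ?D = "\<lambda>q. measure (cos_law c k) {snd q - fst q..snd q} - measure (cos_law 0 k) {snd q - fst q..snd q}"
  let ?s = "\<integral>q. scale_weight (fst q) * (?D q)\<^sup>2 \<partial>(lborel \<Otimes>\<^sub>M lborel)"
  let ?B = "\<lambda>q::real \<times> real. 4 * indicator ({0..\<epsilon>} \<times> {0..3}) q + \<epsilon>\<^sup>2 * indicator ({0..2} \<times> {0..3}) q :: real"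
  have k: "k > 0" using n by (simp add: k_def)
  show "Sigma_rel unif01 (cos_law c k) = ereal ?s"
    using Sigma_rel_cos_law[OF c n] by (simp add: k_def)
  show "0 \<le> ?s" by simp
  have "?s \<le> (\<integral>q. ?B q \<partial>(lborel \<Otimes>\<^sub>M lborel))"
  proof (rule integral_mono')
    show "integrable (lborel \<Otimes>\<^sub>M lborel) ?B"
      by (intro Bochner_Integration.integrable_add integrable_mult_right integrable_rectangle)
    fix q :: "real \<times> real"
    obtain t z where q: "q = (t, z)" by (cases q)
    show "scale_weight (fst q) * (?D q)\<^sup>2 \<le> ?B q"
    proof (cases "0 < t \<and> t \<le> 2 \<and> z \<in> {0..3}")
      case True
      note p = cos_law_window_bounds[OF c k, of t z] and p0 = cos_law_window_bounds[of 0 k t z, OF _ _ k]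
      show ?thesis
      proof (cases "t \<le> \<epsilon>")
        case t: True
        \<comment> \<open>Both masses lie in [0, 2t], hence so does the absolute value of their
          difference.\<close>
        have "\<bar>?D q\<bar> \<le> 2 * t"
          using p(1) p0(1) True measure_nonneg[of "cos_law c k" "{z - t..z}"]
            measure_nonneg[of "cos_law 0 k" "{z - t..z}"] by (auto simp: q abs_le_iff simp del: measure_nonneg)
        then have "(?D q)\<^sup>2 \<le> (2 * t)\<^sup>2"
          by (metis abs_ge_zero power2_abs power_mono)
        then have "scale_weight t * (?D q)\<^sup>2 \<le> 4"
          using True t \<epsilon> by (simp add: scale_weight_def divide_le_eq power_mult_distrib)
        then show ?thesis
          using True t by (simp add: q add_increasing2)
      next
        case t: False
        have "\<bar>?D q\<bar> \<le> \<epsilon>\<^sup>2"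
          using p(4) small True by (simp add: q)
        then have D: "(?D q)\<^sup>2 \<le> (\<epsilon>\<^sup>2)\<^sup>2"
          by (metis abs_ge_zero power2_abs power_mono)
        have "\<epsilon>\<^sup>2 \<le> (min t 1)\<^sup>2"
          using t \<epsilon> by (intro power_mono) auto
        then have "scale_weight t \<le> 1 / \<epsilon>\<^sup>2"
          using True \<epsilon> by (simp add: scale_weight_def frac_le)
        then have "scale_weight t * (?D q)\<^sup>2 \<le> 1 / \<epsilon>\<^sup>2 * (\<epsilon>\<^sup>2)\<^sup>2"
          using D by (intro mult_mono) auto
        also have "\<dots> = \<epsilon>\<^sup>2" using \<epsilon> by (simp add: power2_eq_square)
        finally show ?thesis
          using True t by (simp add: q)
      qed
    next
      case False
      \<comment> \<open>Outside the rectangle either the weight vanishes or both laws give the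
        window mass zero.\<close>
      have zero: "scale_weight (fst q) * (?D q)\<^sup>2 = 0"
      proof (cases "0 < t \<and> t \<le> 2")
        case True
        then show ?thesis
          using False cos_law_window_bounds(3)[OF c k, of t z] cos_law_window_bounds(3)[of 0 k t z, OF _ _ k]
          by (auto simp: q)
      qed (auto simp: q scale_weight_def)
      show ?thesis by (subst zero) simp
    qed
    show "0 \<le> ?B q" by simp
  qed
  also have "\<dots> = 4 * ((\<epsilon> - 0) * (3 - 0)) + \<epsilon>\<^sup>2 * ((2 - 0) * (3 - 0))"
    using \<epsilon> integral_rectangle[of 0 \<epsilon> 0 3] integral_rectangle[of 0 2 0 3]
    by (subst Bochner_Integration.integral_add)
      (auto intro!: integrable_mult_right integrable_rectangle)
  also have "\<dots> \<le> 18 * \<epsilon>"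
    using \<epsilon> by (simp add: power2_eq_square mult_left_le)
  finally show "?s \<le> 18 * \<epsilon>" .
qed

section \<open>Lower bound for the relative entropy\<close>

lemma cos_law_eq_density_unif01:
  "cos_law c k = density unif01 (\<lambda>x. ennreal (1 + c * cos (k * x)))"
  unfolding unif01_eq_cos_law[of k] cos_law_def
  by (subst density_density_eq) (auto simp: mult.commute)

text \<open>With x = r^2, the inequality ln (1/r) \<le> 1/r - 1 gives x ln x \<ge> x - 1 + (r -
  1)^2. Since (x - 1)^2 = (r - 1)^2 (r + 1)^2 and r \<le> 2, the constant 9 is the bound for (r +
  1)^2.\<close>

lemma x_ln_x_ge_quadratic:
  fixes x :: real
  assumes "0 < x" "x \<le> 4"
  shows "x - 1 + (x - 1)\<^sup>2 / 9 \<le> x * ln x"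
proof -
  define r where "r = sqrt x"
  have r: "0 < r" "r \<le> 2" "x = r\<^sup>2"
    using assms real_sqrt_le_mono[of x 4] by (auto simp: r_def)
  have "ln (1 / r) \<le> 1 / r - 1"
    using r by (intro ln_le_minus_one) simp
  then have "r\<^sup>2 * (2 * (1 - 1 / r)) \<le> r\<^sup>2 * ln (r\<^sup>2)"
    using r by (intro mult_left_mono) (auto simp: ln_div ln_realpow)
  moreover have "r\<^sup>2 * (2 * (1 - 1 / r)) = r\<^sup>2 - 1 + (r - 1)\<^sup>2"
    using r by (simp add: field_simps power2_eq_square)
  moreover have "(r\<^sup>2 - 1)\<^sup>2 / 9 \<le> (r - 1)\<^sup>2"
  proof -
    have "(r\<^sup>2 - 1)\<^sup>2 = (r - 1)\<^sup>2 * (r + 1)\<^sup>2"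
      by (simp add: power2_eq_square algebra_simps)
    also have "\<dots> \<le> (r - 1)\<^sup>2 * 3\<^sup>2"
      using r by (intro mult_left_mono power_mono) auto
    finally show ?thesis by simp
  qed
  ultimately show ?thesis unfolding r(3) by linarith
qed

text \<open>The entropy is the integral of g ln g over [0, 1] for the density g. In the quadratic
  lower bound the linear term averages to 0 and cos^2 averages to 1/2 over full periods, leaving c^2
  / 18 for every n.\<close>

lemma rel_entropy_cos_law:
  assumes c: "0 \<le> c" "c \<le> 1/2" and n: "n > 0"
  defines "k \<equiv> 2 * pi * real n"
  shows "rel_entropy (cos_law c k) unif01 = ereal (\<integral>x. ln (1 + c * cos (k * x)) \<partial>cos_law c k)"
    and "c\<^sup>2 / 18 \<le> (\<integral>x. ln (1 + c * cos (k * x)) \<partial>cos_law c k)"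
proof -
  define g where "g x = 1 + c * cos (k * x)" for x
  have [measurable]: "g \<in> borel_measurable borel" unfolding g_def by measurable
  have c1: "c \<le> 1" using c by simp
  \<comment> \<open>The restriction \<open>c\<close> \<le> 1/2 keeps the density away from 0, so its
    logarithm is bounded and hence integrable.\<close>
  have g: "1/2 \<le> g x" "g x \<le> 3/2" for x
  proof -
    have "\<bar>c * cos (k * x)\<bar> \<le> 1/2 * 1" using c unfolding abs_mult by (intro mult_mono) auto
    then show "1/2 \<le> g x" "g x \<le> 3/2" unfolding g_def by linarith+
  qed
  have g_pos: "0 < g x" for x using g(1)[of x] by simp
  interpret P: prob_space "cos_law c k" unfolding k_def by (rule cos_law_basic(1)[OF c(1) c1 n])
  interpret U: prob_space unif01
    using cos_law_basic(1)[of 0 n] n by (simp add: unif01_eq_cos_law[of "2 * pi * real n"])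
  have sets_U [simp, measurable_cong]: "sets unif01 = sets borel"
    by (simp add: unif01_eq_cos_law[of k])
  have dens: "cos_law c k = density unif01 (\<lambda>x. ennreal (g x))"
    by (simp add: cos_law_eq_density_unif01 g_def)
  have ac: "absolutely_continuous unif01 (cos_law c k)"
    unfolding dens by (rule absolutely_continuousI_density) measurable
  have "AE x in unif01. ennreal (g x) = RN_deriv unif01 (cos_law c k) x"
    using dens by (intro U.RN_deriv_unique) auto
  \<comment> \<open>The density is identified almost everywhere for the uniform law; absolute
    continuity transfers this to the law over which the entropy integrates.\<close>
  then have RN: "AE x in cos_law c k. ennreal (g x) = RN_deriv unif01 (cos_law c k) x"
    by (rule absolutely_continuous_AE[OF _ ac, rotated]) simp
  have bnd: "\<bar>ln (g x)\<bar> \<le> ln 2" for x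
  proof -
    have "ln (1/2) \<le> ln (g x)" "ln (g x) \<le> ln 2"
      using g[of x] by (subst ln_le_cancel_iff; simp)+
    then show ?thesis by (simp add: ln_div abs_le_iff)
  qed
  have int: "integrable (cos_law c k) (\<lambda>x. ln (g x))"
    by (rule P.integrable_const_bound[where B = "ln 2"]) (auto simp: bnd)
  have "rel_entropy (cos_law c k) unif01 = ext_integral (cos_law c k) (\<lambda>x. ereal (ln (g x)))"
    unfolding rel_entropy_def using ac RN g_pos
    by (auto intro!: ext_integral_cong_AE elim!: eventually_mono simp: less_imp_le) (metis enn2real_ennreal less_imp_le)
  then show "rel_entropy (cos_law c k) unif01 = ereal (\<integral>x. ln (1 + c * cos (k * x)) \<partial>cos_law c k)"
    using ext_integral_integrable[OF int] by (simp add: g_def)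
  let ?q = "\<lambda>x. (g x - 1 + (g x - 1)\<^sup>2 / 9) * indicator {0..1} x"
  have dens': "cos_law c k = density lborel (\<lambda>x. ennreal (g x * indicator {0..1} x))"
    unfolding cos_law_def g_def by (intro arg_cong[where f = "density lborel"]) (auto simp: indicator_def)
  have int_lb: "integrable lborel (\<lambda>x. (g x * indicator {0..1} x) * ln (g x))"
    using int unfolding dens'
    by (subst (asm) integrable_density) (auto simp: g_pos less_imp_le)
  have "c\<^sup>2 / 18 = integral\<^sup>L lborel ?q"
  proof -
    have k: "k \<noteq> 0" using n by (simp add: k_def)
    have sin0: "sin k = 0" "sin (2 * k) = 0"
      using sin_2npi[of n] sin_2npi[of "2 * n"] by (simp_all add: k_def algebra_simps)
    \<comment> \<open>The primitive uses cos^2 (k x) = 1/2 + cos (2 k x) / 2; its sine terms vanish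
      at both endpoints.\<close>
    have "(\<integral>x. (g x - 1 + (g x - 1)\<^sup>2 / 9) * indicator {0..1} x \<partial>lborel)
      = (c * sin (k * 1) / k + c\<^sup>2 / 9 * (1 / 2 + sin (2 * k * 1) / (4 * k)))
        - (c * sin (k * 0) / k + c\<^sup>2 / 9 * (0 / 2 + sin (2 * k * 0) / (4 * k)))"
    proof (rule integral_FTC_Icc_real)
      fix x :: real
      have "(cos (k * x))\<^sup>2 = 1 / 2 + cos (2 * k * x) / 2"
        using cos_double_cos[of "k * x"] by (simp add: mult.assoc field_simps)
      then show "((\<lambda>x. c * sin (k * x) / k + c\<^sup>2 / 9 * (x / 2 + sin (2 * k * x) / (4 * k)))
          has_real_derivative (g x - 1 + (g x - 1)\<^sup>2 / 9)) (at x)"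
        unfolding g_def using k
        by (auto intro!: derivative_eq_intros simp: power_mult_distrib)
      show "isCont (\<lambda>x. g x - 1 + (g x - 1)\<^sup>2 / 9) x"
        unfolding g_def by (intro continuous_intros) auto
    qed simp
    then show ?thesis using sin0 by simp
  qed
  also have "\<dots> \<le> (\<integral>x. (g x * indicator {0..1} x) * ln (g x) \<partial>lborel)"
  proof (rule integral_mono)
    show "integrable lborel ?q"
      unfolding g_def by (intro integrable_real_mult_indicator borel_integrable_atLeastAtMost)
         (auto intro!: continuous_intros)
    show "?q x \<le> g x * indicator {0..1} x * ln (g x)" for x
      using x_ln_x_ge_quadratic[of "g x"] g[of x] by (auto simp: indicator_def)
  qed (rule int_lb)
  also have "\<dots> = (\<integral>x. ln (g x) \<partial>cos_law c k)"
    unfolding dens' by (subst integral_density) (auto simp: g_pos less_imp_le)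
  finally show "c\<^sup>2 / 18 \<le> (\<integral>x. ln (1 + c * cos (k * x)) \<partial>cos_law c k)"
    by (simp add: g_def)
qed

section \<open>Unboundedness of the ratio of entropy to energy\<close>

text \<open>At amplitude 1/2 the entropy is at least 1/72 for every frequency, while the energy
  becomes arbitrarily small, so the frequency can be chosen after \<open>M\<close>. The product form
  \<open>M * s < h\<close> avoids dividing by an energy that might be 0.\<close>

lemma rel_entropy_large_compared_to_Sigma_rel:
  assumes "M > 0"
  obtains \<nu> h s where "\<nu> \<in> prob_unit - {unif01}"
    "rel_entropy \<nu> unif01 = ereal h" "Sigma_rel unif01 \<nu> = ereal s" "0 < h" "0 \<le> s" "M * s < h"
proof -
  \<comment> \<open>The constant 1297 exceeds 18 * 72 = 1296, so \<open>M\<close> times the energy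
    bound 18\<epsilon> stays below 1/72.\<close>
  define \<epsilon> where "\<epsilon> = 1 / (1 + 1297 * M)"
  have \<epsilon>: "0 < \<epsilon>" "\<epsilon> \<le> 1" "M * (18 * \<epsilon>) < 1/72"
    using assms by (auto simp: \<epsilon>_def field_simps)
  obtain n :: nat where n: "n > 0" "1 / real n < \<epsilon>\<^sup>2"
    using nat_approx_posE[of "\<epsilon>\<^sup>2"] \<epsilon> by (metis zero_less_Suc zero_less_power)
  define k where "k = 2 * pi * real n"
  have "1 / k \<le> 1 / real n"
    using n pi_gt3 by (intro divide_left_mono) (auto simp: k_def)
  then have small: "2 * (1/2) / k \<le> \<epsilon>\<^sup>2" using n by simp
  obtain s where s: "Sigma_rel unif01 (cos_law (1/2) k) = ereal s" "0 \<le> s" "s \<le> 18 * \<epsilon>"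
    using Sigma_rel_cos_law_bounds[of "1/2" n \<epsilon>] n \<epsilon> small unfolding k_def by auto
  obtain h where h: "rel_entropy (cos_law (1/2) k) unif01 = ereal h" "1/72 \<le> h"
    using rel_entropy_cos_law[of "1/2" n] n unfolding k_def by (auto simp: power2_eq_square)
  \<comment> \<open>Zero entropy of the uniform law against itself separates it from the law just
    built, whose entropy is positive.\<close>
  have "rel_entropy unif01 unif01 = 0"
    using rel_entropy_cos_law(1)[of 0 n] n by (simp add: unif01_eq_cos_law[symmetric] zero_ereal_def)
  then have "cos_law (1/2) k \<noteq> unif01" using h by (auto simp: zero_ereal_def)
  moreover have "cos_law (1/2) k \<in> prob_unit"
    using cos_law_basic(4)[of "1/2" n] n by (simp add: k_def)
  moreover have "M * s < h"
    using mult_left_mono[OF s(3), of M] assms \<epsilon> h by linarith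
  ultimately show ?thesis
    using that[of "cos_law (1/2) k" h s] h s by simp
qed

theorem proposition1p5:
  shows "(SUP \<nu> \<in> prob_unit - {unif01}. rel_entropy \<nu> unif01 / Sigma_rel unif01 \<nu>) = \<infinity>
    \<and> \<not> (\<exists>C::real. \<forall>\<nu> \<in> prob_unit. rel_entropy \<nu> unif01 \<le> ereal C * Sigma_rel unif01 \<nu>)"
proof
  show "(SUP \<nu> \<in> prob_unit - {unif01}. rel_entropy \<nu> unif01 / Sigma_rel unif01 \<nu>) = \<infinity>"
  proof (rule ereal_top)
    fix B :: real
    obtain \<nu> h s where \<nu>: "\<nu> \<in> prob_unit - {unif01}"
      and h: "rel_entropy \<nu> unif01 = ereal h" "0 < h"
      and s: "Sigma_rel unif01 \<nu> = ereal s" "0 \<le> s" "max 1 B * s < h"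
      \<comment> \<open>Passing to \<open>max 1 B\<close> supplies a positive constant, and as s
        \<ge> 0 the resulting bound implies the one for \<open>B\<close>.\<close>
      using rel_entropy_large_compared_to_Sigma_rel[of "max 1 B"] by (metis less_max_iff_disj zero_less_one)
    have "ereal B \<le> ereal h / ereal s"
    proof (cases "s = 0")
      case True
      \<comment> \<open>A positive number divided by 0 is \<infinity> in
        \<open>ereal\<close>.\<close>
      then show ?thesis using h by (simp add: divide_ereal_def zero_ereal_def[symmetric])
    next
      case False
      have "B * s \<le> max 1 B * s" using s by (intro mult_right_mono) auto
      then have "B * s \<le> h" using s by linarith
      then show ?thesis using False s by (simp add: le_divide_eq)
    qed
    also have "\<dots> \<le> (SUP \<nu> \<in> prob_unit - {unif01}. rel_entropy \<nu> unif01 / Sigma_rel unif01 \<nu>)"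
      using SUP_upper[OF \<nu>, of "\<lambda>\<nu>. rel_entropy \<nu> unif01 / Sigma_rel unif01 \<nu>"] h s by simp
    finally show "ereal B \<le> (SUP \<nu> \<in> prob_unit - {unif01}. rel_entropy \<nu> unif01 / Sigma_rel unif01 \<nu>)" .
  qed
  show "\<not> (\<exists>C::real. \<forall>\<nu> \<in> prob_unit. rel_entropy \<nu> unif01 \<le> ereal C * Sigma_rel unif01 \<nu>)"
  proof
    assume "\<exists>C::real. \<forall>\<nu> \<in> prob_unit. rel_entropy \<nu> unif01 \<le> ereal C * Sigma_rel unif01 \<nu>"
    then obtain C :: real where C: "\<And>\<nu>. \<nu> \<in> prob_unit \<Longrightarrow> rel_entropy \<nu> unif01 \<le> ereal C * Sigma_rel unif01 \<nu>"
      by blast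
    obtain \<nu> h s where \<nu>: "\<nu> \<in> prob_unit - {unif01}"
      and h: "rel_entropy \<nu> unif01 = ereal h" "0 < h"
      and s: "Sigma_rel unif01 \<nu> = ereal s" "0 \<le> s" "max 1 C * s < h"
      using rel_entropy_large_compared_to_Sigma_rel[of "max 1 C"] by (metis less_max_iff_disj zero_less_one)
    have "C * s \<le> max 1 C * s" using s by (intro mult_right_mono) auto
    then show False using C[of \<nu>] \<nu> h s by simp
  qed
qed

end
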